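(* Let $\mathbb{K}$ be any field, and let $G$ be a group. Then $G$ is amenable if and only if its group algebra $\mathbb{K}G$ is amenable.
   Context: A (discrete) group $G$ is amenable if there exists a function $\mu:2^G\to[0,1]$ such that $\mu(G)=1$, and $\mu(A\sqcup B)=\mu(A)+\mu(B)$ and $\mu(Ag)=\mu(A)$ for all disjoint $A,B\subseteq G$ and all $g\in G$. An associative $\mathbb{K}$-algebra $R$ is amenable if it is amenable as a right module over itself, i.e. if for every $\epsilon>0$ and every finite-dimensional subspace $S$ of $R$ there exists a finite-dimensional (nonzero) subspace $F$ of $R$ such that $$\frac{\dim_{\mathbb{K}}((F+Fs)/F)}{\dim_{\mathbb{K}}(F)}<\epsilon\quad\text{for all }s\in S.$$ *)

theory Defs
  imports Complex_Main "HOL-Library.Poly_Mapping" "HOL-Library.Set_Algebras"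
begin

section \<open>Amenable groups\<close>

text \<open>
  A group is the type \<open>'g\<close> of class \<open>group_add\<close>: the operation is written additively
  but is not assumed to be commutative.
\<close>

definition amenable_group :: "'g::group_add itself \<Rightarrow> bool" where
  "amenable_group (_ :: 'g itself) \<longleftrightarrow>
    (\<exists>\<mu> :: 'g set \<Rightarrow> real.
      (\<forall>A. \<mu> A \<in> {0..1}) \<and>
      \<mu> UNIV = 1 \<and>
      (\<forall>A B. A \<inter> B = {} \<longrightarrow> \<mu> (A \<union> B) = \<mu> A + \<mu> B) \<and>
      (\<forall>A g. \<mu> ((\<lambda>a. a + g) ` A) = \<mu> A))"


section \<open>Amenable algebras\<close>

locale assoc_algebra = vector_space scale
  for scale :: "'k::field \<Rightarrow> 'r::ring \<Rightarrow> 'r" +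
  assumes scale_mult_left: "scale c x * y = scale c (x * y)"
    and scale_mult_right: "x * scale c y = scale c (x * y)"
begin

definition fin_dim_subspace :: "'r set \<Rightarrow> bool" where
  "fin_dim_subspace V \<longleftrightarrow> subspace V \<and> (\<exists>B. finite B \<and> span B = V)"

text \<open>The quotient space \<open>V/F\<close>, as a set of cosets \<open>v + F\<close>.\<close>

definition quotient_space :: "'r set \<Rightarrow> 'r set \<Rightarrow> 'r set set" where
  "quotient_space V F = (\<lambda>v. v +o F) ` V"

text \<open>
  The linear combination in \<open>V/F\<close> of the cosets \<open>A \<in> T\<close> with coefficients \<open>c A\<close>, the sums being
  elementwise sums of sets. The summand \<open>F\<close> accounts for \<open>0 \<cdot> A\<close> and the empty sum, which
  elementwise are \<open>{0}\<close> whereas the zero vector of \<open>V/F\<close> is \<open>F\<close>.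
\<close>

definition quotient_comb :: "'r set \<Rightarrow> ('r set \<Rightarrow> 'k) \<Rightarrow> 'r set set \<Rightarrow> 'r set" where
  "quotient_comb F c T = (\<Sum>A\<in>T. scale (c A) ` A) + F"

definition quotient_basis :: "'r set \<Rightarrow> 'r set \<Rightarrow> 'r set set \<Rightarrow> bool" where
  "quotient_basis V F B \<longleftrightarrow>
    B \<subseteq> quotient_space V F \<and>
    (\<forall>T c. finite T \<and> T \<subseteq> B \<and> quotient_comb F c T = F \<longrightarrow> (\<forall>A\<in>T. c A = 0)) \<and>
    (\<forall>X\<in>quotient_space V F. \<exists>T c. finite T \<and> T \<subseteq> B \<and> X = quotient_comb F c T)"

text \<open>Like \<open>dim\<close>, this is \<open>0\<close> for infinite-dimensional quotients.\<close>

definition dim_quotient :: "'r set \<Rightarrow> 'r set \<Rightarrow> nat" where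
  "dim_quotient V F = card (SOME B. quotient_basis V F B)"

definition amenable :: bool where
  "amenable \<longleftrightarrow>
    (\<forall>\<epsilon>::real. \<epsilon> > 0 \<longrightarrow> (\<forall>S. fin_dim_subspace S \<longrightarrow>
      (\<exists>F. fin_dim_subspace F \<and> F \<noteq> {0} \<and>
        (\<forall>s\<in>S. real (dim_quotient (F + (\<lambda>f. f * s) ` F) F) / real (dim F) < \<epsilon>))))"

text \<open>Agreement of \<open>dim_quotient\<close> with the codimension.\<close>

lemma coset_iff: "(x :: 'r) \<in> v +o F \<longleftrightarrow> x - v \<in> F"
  by (auto simp: elt_set_plus_def algebra_simps intro: bexI[of _ "x - v"])

lemma coset_eq_iff:
  assumes "subspace F"
  shows "v +o F = w +o F \<longleftrightarrow> v - w \<in> F"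
proof
  assume "v +o F = w +o F"
  moreover have "v \<in> v +o F" using assms by (simp add: coset_iff subspace_0)
  ultimately show "v - w \<in> F" by (simp add: coset_iff)
next
  assume *: "v - w \<in> F"
  have "x - v \<in> F \<longleftrightarrow> x - w \<in> F" for x
    using subspace_add[OF assms _ *, of "x - v"] subspace_diff[OF assms _ *, of "x - w"]
    by (auto simp: algebra_simps)
  then show "v +o F = w +o F" by (auto simp: coset_iff)
qed

lemma quotient_comb_coset:
  assumes F: "subspace F" and "finite T" and "\<And>A. A \<in> T \<Longrightarrow> A = r A +o F"
  shows "quotient_comb F c T = (\<Sum>A\<in>T. scale (c A) (r A)) +o F"
  using assms(2,3)
proof (induction T rule: finite_induct)
  case empty
  then show ?case by (simp add: quotient_comb_def)
next
  case (insert A T)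
  have IH: "quotient_comb F c T = (\<Sum>A\<in>T. scale (c A) (r A)) +o F" using insert by auto
  have A: "A = r A +o F" using insert by blast
  let ?s = "\<Sum>A\<in>T. scale (c A) (r A)"
  have "quotient_comb F c (insert A T) = scale (c A) ` A + quotient_comb F c T"
    using insert by (simp add: quotient_comb_def add.assoc)
  also have "\<dots> = scale (c A) ` (r A +o F) + (?s +o F)"
    using A IH by simp
  also have "\<dots> = (scale (c A) (r A) + ?s) +o F"
  proof (intro set_eqI iffI)
    fix x assume "x \<in> scale (c A) ` (r A +o F) + (?s +o F)"
    then obtain f g where "f \<in> F" "g \<in> F" "x = scale (c A) (r A + f) + (?s + g)"
      by (auto simp: set_plus_def elt_set_plus_def)
    then show "x \<in> (scale (c A) (r A) + ?s) +o F"
      using F by (auto simp: coset_iff algebra_simps scale_right_distrib subspace_add subspace_scale)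
  next
    fix x assume "x \<in> (scale (c A) (r A) + ?s) +o F"
    then obtain f where f: "f \<in> F" "x = scale (c A) (r A + 0) + (?s + f)"
      by (auto simp: elt_set_plus_def algebra_simps)
    then show "x \<in> scale (c A) ` (r A +o F) + (?s +o F)"
      unfolding set_plus_def elt_set_plus_def using subspace_0[OF F] by blast
  qed
  finally show ?case using insert by simp
qed

lemma quotient_basis_exists:
  assumes F: "subspace F" and V: "subspace V" "F \<subseteq> V"
  shows "\<exists>B. quotient_basis V F B"
proof -
  obtain C where C: "C \<subseteq> F" "independent C" "F \<subseteq> span C"
    using basis_exists[of F] by metis
  have spC: "span C = F" using C F by (simp add: span_subspace)
  obtain D where D: "C \<subseteq> D" "D \<subseteq> V" "independent D" "V \<subseteq> span D"
    by (rule maximal_independent_subset_extend[of C V]) (use C V in auto)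
  let ?q = "\<lambda>v. v +o F"
  define E where "E = D - C"
  have CE: "C \<inter> E = {}" "D = C \<union> E" using D by (auto simp: E_def)
  have spD: "span D = V" using D V by (simp add: span_subspace)
  have indep0: "\<forall>e\<in>U. u e = 0"
    if U: "finite U" "U \<subseteq> E" "(\<Sum>e\<in>U. scale (u e) e) \<in> F" for U u
  proof -
    obtain W w where W: "finite W" "W \<subseteq> C" "(\<Sum>e\<in>U. scale (u e) e) = (\<Sum>e\<in>W. scale (w e) e)"
      using U(3) unfolding spC[symmetric] span_explicit by blast
    define z where "z e = (if e \<in> U then u e else - w e)" for e
    have dj: "U \<inter> W = {}" using U W CE by auto
    have "(\<Sum>e\<in>U \<union> W. scale (z e) e) = (\<Sum>e\<in>U. scale (z e) e) + (\<Sum>e\<in>W. scale (z e) e)"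
      using U W dj by (simp add: sum.union_disjoint)
    also have "(\<Sum>e\<in>U. scale (z e) e) = (\<Sum>e\<in>U. scale (u e) e)"
      by (rule sum.cong) (auto simp: z_def)
    also have "(\<Sum>e\<in>W. scale (z e) e) = (\<Sum>e\<in>W. - scale (w e) e)"
      using dj by (intro sum.cong) (auto simp: z_def)
    finally have "(\<Sum>e\<in>U \<union> W. scale (z e) e) = 0" using W(3) by (simp add: sum_negf)
    then have "\<forall>e\<in>U \<union> W. z e = 0"
      using independentD[OF D(3), of "U \<union> W" z] U W CE by blast
    then show ?thesis by (metis UnI1 z_def)
  qed
  have injE: "inj_on ?q E"
  proof (rule inj_onI, rule ccontr)
    fix x y assume xy: "x \<in> E" "y \<in> E" "?q x = ?q y" "x \<noteq> y"
    have "(\<Sum>e\<in>{x,y}. scale (if e = x then 1 else -1) e) \<in> F"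
      using xy coset_eq_iff[OF F] by simp
    from indep0[OF _ _ this] xy show False by auto
  qed
  have comb: "quotient_comb F c (?q ` U) = (\<Sum>e\<in>U. scale (c (?q e)) e) +o F"
    if "finite U" "U \<subseteq> E" for U c
  proof -
    have inj: "inj_on ?q U" using injE that inj_on_subset by blast
    have "quotient_comb F c (?q ` U) = (\<Sum>A\<in>?q ` U. scale (c A) (inv_into U ?q A)) +o F"
      using that by (intro quotient_comb_coset[OF F]) (auto simp: f_inv_into_f inv_into_f_f[OF inj])
    also have "(\<Sum>A\<in>?q ` U. scale (c A) (inv_into U ?q A)) = (\<Sum>e\<in>U. scale (c (?q e)) e)"
      by (simp add: sum.reindex[OF inj] inv_into_f_f[OF inj])
    finally show ?thesis .
  qed
  have "quotient_basis V F (?q ` E)"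
    unfolding quotient_basis_def
  proof (intro conjI allI impI ballI)
    show "?q ` E \<subseteq> quotient_space V F" using D by (auto simp: quotient_space_def E_def)
  next
    fix T c A assume *: "finite T \<and> T \<subseteq> ?q ` E \<and> quotient_comb F c T = F" and "A \<in> T"
    then obtain U where U: "U \<subseteq> E" "finite U" "T = ?q ` U"
      using finite_subset_image[of T ?q E] by blast
    have "(\<Sum>e\<in>U. scale (c (?q e)) e) +o F = 0 +o F" using * comb[of U c] U by simp
    then have "(\<Sum>e\<in>U. scale (c (?q e)) e) \<in> F" using coset_eq_iff[OF F, of _ 0] by (metis diff_zero)
    from indep0[OF U(2,1) this] \<open>A \<in> T\<close> U show "c A = 0" by auto
  next
    fix X assume "X \<in> quotient_space V F"
    then obtain v where v: "v \<in> V" "X = ?q v" by (auto simp: quotient_space_def)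
    then have "v \<in> span (C \<union> E)" using spD CE by simp
    then obtain a b where ab: "v = a + b" "a \<in> F" "b \<in> span E"
      unfolding span_Un spC by auto
    then obtain U u where U: "finite U" "U \<subseteq> E" "b = (\<Sum>e\<in>U. scale (u e) e)"
      unfolding span_explicit by blast
    define c where "c A = u (inv_into E ?q A)" for A
    have "c (?q e) = u e" if "e \<in> U" for e
      using that U by (auto simp: c_def inv_into_f_f[OF injE])
    then have "quotient_comb F c (?q ` U) = ?q b" using comb[of U c] U by simp
    also have "\<dots> = X" using v ab F by (simp add: coset_eq_iff subspace_neg)
    finally show "\<exists>T c. finite T \<and> T \<subseteq> ?q ` E \<and> X = quotient_comb F c T"
      using U by (intro exI[of _ "?q ` U"] exI[of _ c]) auto
  qed
  then show ?thesis ..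
qed

lemma card_quotient_basis:
  assumes F: "subspace F" and V: "fin_dim_subspace V" "F \<subseteq> V" and B: "quotient_basis V F B"
  shows "card B + dim F = dim V"
proof -
  obtain G where G: "finite G" "span G = V" and sV: "subspace V"
    using V by (auto simp: fin_dim_subspace_def)
  obtain C where C: "C \<subseteq> F" "independent C" "F \<subseteq> span C" "card C = dim F"
    using basis_exists[of F] by auto
  have spC: "span C = F" using C F by (simp add: span_subspace)
  have "\<forall>A\<in>B. \<exists>v\<in>V. A = v +o F" using B by (auto simp: quotient_basis_def quotient_space_def)
  then obtain r where r: "\<And>A. A \<in> B \<Longrightarrow> r A \<in> V" "\<And>A. A \<in> B \<Longrightarrow> A = r A +o F" by metis
  have Bind: "\<And>T c A. finite T \<Longrightarrow> T \<subseteq> B \<Longrightarrow> quotient_comb F c T = F \<Longrightarrow> A \<in> T \<Longrightarrow> c A = 0"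
    using B unfolding quotient_basis_def by blast
  have Bspan: "\<forall>X\<in>quotient_space V F. \<exists>T c. finite T \<and> T \<subseteq> B \<and> X = quotient_comb F c T"
    using B unfolding quotient_basis_def by (elim conjE)
  have inj: "inj_on r B" using r(2) by (metis inj_onI)
  have ind: "\<forall>A\<in>T. c A = 0"
    if "finite T" "T \<subseteq> B" "(\<Sum>A\<in>T. scale (c A) (r A)) \<in> F" for T c
  proof -
    have "quotient_comb F c T = (\<Sum>A\<in>T. scale (c A) (r A)) +o F"
      using that r(2) by (intro quotient_comb_coset[OF F]) auto
    also have "\<dots> = 0 +o F" using that by (subst coset_eq_iff[OF F]) simp
    finally show ?thesis using Bind that by simp
  qed
  have dj: "r ` B \<inter> C = {}"
  proof (rule ccontr)
    assume "r ` B \<inter> C \<noteq> {}"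
    then obtain A where "A \<in> B" "r A \<in> F" using C by auto
    with ind[of "{A}" "\<lambda>_. 1"] show False by simp
  qed
  have ind2: "independent (r ` B \<union> C)"
    unfolding independent_explicit_module
  proof (intro allI impI)
    fix t u v assume t: "finite t" "t \<subseteq> r ` B \<union> C" "(\<Sum>v\<in>t. scale (u v) v) = 0" "v \<in> t"
    let ?t2 = "t \<inter> C"
    obtain T where T: "T \<subseteq> B" "finite T" "t \<inter> r ` B = r ` T"
      using finite_subset_image[of "t \<inter> r ` B" r B] t(1) by auto
    have eq: "t = r ` T \<union> ?t2" "r ` T \<inter> ?t2 = {}" using t T dj by blast+
    have iT: "inj_on r T" using inj T inj_on_subset by blast
    have "(\<Sum>v\<in>t. scale (u v) v) = (\<Sum>v\<in>r ` T. scale (u v) v) + (\<Sum>v\<in>?t2. scale (u v) v)"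
      using sum.union_disjoint[of "r ` T" ?t2 "\<lambda>v. scale (u v) v"] eq T t by simp
    then have s: "(\<Sum>A\<in>T. scale (u (r A)) (r A)) + (\<Sum>v\<in>?t2. scale (u v) v) = 0"
      using t by (simp add: sum.reindex[OF iT])
    have m: "(\<Sum>v\<in>?t2. scale (u v) v) \<in> F"
      using C by (intro subspace_sum[OF F] subspace_scale[OF F]) auto
    have "(\<Sum>A\<in>T. scale (u (r A)) (r A)) = - (\<Sum>v\<in>?t2. scale (u v) v)"
      using s by (simp add: eq_neg_iff_add_eq_0)
    then have "(\<Sum>A\<in>T. scale (u (r A)) (r A)) \<in> F" using subspace_neg[OF F m] by simp
    from ind[OF T(2,1) this] have z: "\<forall>A\<in>T. u (r A) = 0" by simp
    then have "(\<Sum>v\<in>?t2. scale (u v) v) = 0" using s by simp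
    then have "\<forall>v\<in>?t2. u v = 0" using independentD[OF C(2), of ?t2 u] t by blast
    moreover have "v \<in> r ` T \<or> v \<in> ?t2" using t(4) eq(1) by (metis UnE)
    ultimately show "u v = 0" using z by auto
  qed
  have sub: "r ` B \<union> C \<subseteq> V" using r C V by auto
  have "V \<subseteq> span (r ` B \<union> C)"
  proof
    fix v assume "v \<in> V"
    then have "v +o F \<in> quotient_space V F" by (auto simp: quotient_space_def)
    then obtain T c where T: "finite T" "T \<subseteq> B" "v +o F = quotient_comb F c T"
      using Bspan by metis
    have "quotient_comb F c T = (\<Sum>A\<in>T. scale (c A) (r A)) +o F"
      using T r(2) by (intro quotient_comb_coset[OF F]) auto
    then have *: "v - (\<Sum>A\<in>T. scale (c A) (r A)) \<in> span C" using T coset_eq_iff[OF F] spC by simp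
    have "(\<Sum>A\<in>T. scale (c A) (r A)) \<in> span (r ` B \<union> C)"
      using T by (intro span_sum span_scale span_base) auto
    moreover have "v - (\<Sum>A\<in>T. scale (c A) (r A)) \<in> span (r ` B \<union> C)"
      using * span_mono[of C "r ` B \<union> C"] by auto
    ultimately show "v \<in> span (r ` B \<union> C)"
      using span_add by fastforce
  qed
  then have "card (r ` B \<union> C) = dim V"
    using sub ind2 by (intro basis_card_eq_dim) auto
  moreover have "finite (r ` B \<union> C)"
    using independent_span_bound[OF G(1) ind2] sub G(2) by blast
  ultimately show ?thesis
    using dj C(4) by (simp add: card_Un_disjoint card_image[OF inj])
qed

lemma dim_quotient_eq:
  assumes "subspace F" "fin_dim_subspace V" "F \<subseteq> V"
  shows "dim_quotient V F = dim V - dim F"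
proof -
  have "quotient_basis V F (SOME B. quotient_basis V F B)"
    using quotient_basis_exists[of F V] assms by (auto simp: fin_dim_subspace_def intro: someI_ex)
  then show ?thesis using card_quotient_basis[of F V] assms by (fastforce simp: dim_quotient_def)
qed

end


section \<open>Group algebras\<close>

text \<open>
  The ring underlying the group algebra is the type of finitely supported functions
  \<open>'g \<Rightarrow>\<^sub>0 'k\<close>, whose multiplication is convolution.
\<close>

definition group_algebra_scale :: "'k::field \<Rightarrow> ('g::group_add \<Rightarrow>\<^sub>0 'k) \<Rightarrow> ('g \<Rightarrow>\<^sub>0 'k)" where
  "group_algebra_scale c x = Poly_Mapping.map ((*) c) x"

lemma lookup_group_algebra_scale:
  "Poly_Mapping.lookup (group_algebra_scale c x) g = c * Poly_Mapping.lookup x g"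
  by (simp add: group_algebra_scale_def Poly_Mapping.map.rep_eq when_def)

lemma group_algebra_scale_conv_mult:
  "group_algebra_scale c x = Poly_Mapping.single 0 c * x"
  by (simp add: group_algebra_scale_def mult_map_scale_conv_mult)

lemma single_0_commute:
  fixes x :: "'g::group_add \<Rightarrow>\<^sub>0 'k::field"
  shows "x * Poly_Mapping.single 0 c = Poly_Mapping.single 0 c * x"
proof (rule poly_mapping_eqI)
  fix g :: 'g
  have inner: "(\<Sum>q. (c when 0 = q) when g = l + q) = (if l = g then c else 0)" for l
  proof -
    have "(\<Sum>q. (c when 0 = q) when g = l + q) = (\<Sum>q::'g. if q = 0 then (if l = g then c else 0) else 0)"
      by (rule arg_cong[where f = Sum_any]) (auto simp: when_def fun_eq_iff)
    then show ?thesis by simp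
  qed
  have "Poly_Mapping.lookup (x * Poly_Mapping.single 0 c) g =
      (\<Sum>l. if l = g then Poly_Mapping.lookup x l * c else 0)"
    unfolding lookup_mult lookup_single inner by (rule arg_cong[where f = Sum_any]) (auto simp: fun_eq_iff)
  also have "\<dots> = c * Poly_Mapping.lookup x g" by (simp add: mult.commute)
  finally show "Poly_Mapping.lookup (x * Poly_Mapping.single 0 c) g =
      Poly_Mapping.lookup (Poly_Mapping.single 0 c * x) g"
    by (simp add: lookup_group_algebra_scale flip: group_algebra_scale_conv_mult)
qed

lemma assoc_algebra_group_algebra:
  "assoc_algebra (group_algebra_scale :: 'k::field \<Rightarrow> ('g::group_add \<Rightarrow>\<^sub>0 'k) \<Rightarrow> _)"
proof
  fix a b :: 'k and x y :: "'g \<Rightarrow>\<^sub>0 'k"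
  show "group_algebra_scale a (x + y) = group_algebra_scale a x + group_algebra_scale a y"
    and "group_algebra_scale (a + b) x = group_algebra_scale a x + group_algebra_scale b x"
    and "group_algebra_scale a (group_algebra_scale b x) = group_algebra_scale (a * b) x"
    and "group_algebra_scale 1 x = x"
    by (rule poly_mapping_eqI; simp add: lookup_group_algebra_scale lookup_add algebra_simps)+
  show "group_algebra_scale a x * y = group_algebra_scale a (x * y)"
    by (simp add: group_algebra_scale_conv_mult mult.assoc)
  show "x * group_algebra_scale a y = group_algebra_scale a (x * y)"
    by (simp add: group_algebra_scale_conv_mult single_0_commute flip: mult.assoc)
qed

end

theory Submission
  imports Defs "HOL-Analysis.Function_Topology"
begin

text \<open>
  If \<open>G\<close> fails Folner's condition, then some finite set \<open>S\<close> satisfies \<open>2 |A| \<le> |A S|\<close> for all finite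
  \<open>A\<close>, and the infinite marriage theorem gives a paradoxical decomposition, so \<open>G\<close> has no invariant
  mean. If \<open>G\<close> satisfies it, the elements supported on a Folner set form an almost invariant
  subspace of the group algebra.

  Conversely, given a finite-dimensional subspace \<open>F\<close> of the group algebra, every ordering of the
  support of \<open>F\<close> determines a set of \<open>dim F\<close> leading positions of elements of \<open>F\<close>. Averaging over all
  orderings yields a weight on \<open>G\<close> of total mass \<open>dim F\<close> which is monotone in \<open>F\<close> and commutes with
  translations. Comparing the weights of \<open>F\<close>, \<open>F g\<close> and \<open>F + F g\<close> shows that for an almost invariant
  \<open>F\<close> the normalised weight is an almost invariant mean; an invariant mean exists by compactness.
\<close>

section \<open>Means and Folner sets\<close>

text \<open>
  Rado's argument: in a family that is minimal among the shrinkings satisfying Hall's condition every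
  set is a singleton.
\<close>

lemma hall_selection:
  fixes X :: "'i \<Rightarrow> 'a set"
  assumes fin: "\<And>i. finite (X i)"
    and hall: "\<And>J. finite J \<Longrightarrow> card J \<le> card (\<Union>i\<in>J. X i)"
  shows "\<exists>f. inj f \<and> (\<forall>i. f i \<in> X i)"
proof -
  \<comment> \<open>A shrinking is coded by the set \<open>R\<close> of deleted pairs, so a minimal
    family is a maximal \<open>R\<close>, as Zorn's lemma provides.\<close>
  define Y where "Y R i = X i - R `` {i}" for R :: "('i \<times> 'a) set" and i
  define \<A> where "\<A> = {R. \<forall>J. finite J \<longrightarrow> card J \<le> card (\<Union>i\<in>J. Y R i)}"
  have finY: "finite (\<Union>i\<in>J. Y R i)" if "finite J" for J R
    using that fin by (auto simp: Y_def)
  have "{} \<in> \<A>" using hall by (auto simp: \<A>_def Y_def)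
  then have ne: "\<A> \<noteq> {}" by auto
  have "\<exists>M\<in>\<A>. \<forall>R\<in>\<A>. M \<subseteq> R \<longrightarrow> R = M"
  proof (rule subset_Zorn_nonempty[OF ne])
    fix C assume C: "C \<noteq> {}" "subset.chain \<A> C"
    show "\<Union>C \<in> \<A>"
      unfolding \<A>_def
    proof (intro CollectI allI impI)
      fix J :: "'i set" assume J: "finite J"
      \<comment> \<open>Only finitely many deletions concern \<open>J\<close>, so one member of the
        chain already contains them all.\<close>
      have "finite (Sigma J X \<inter> \<Union>C)" using J fin by blast
      then obtain R where R: "R \<in> C" "Sigma J X \<inter> \<Union>C \<subseteq> R"
        by (rule finite_subset_Union_chain[OF _ _ C]) auto
      have "card J \<le> card (\<Union>i\<in>J. Y R i)"
        using R C J by (auto simp: \<A>_def subset.chain_def)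
      also have "\<dots> \<le> card (\<Union>i\<in>J. Y (\<Union>C) i)"
        using R by (intro card_mono finY J) (auto simp: Y_def)
      finally show "card J \<le> card (\<Union>i\<in>J. Y (\<Union>C) i)" .
    qed
  qed
  then obtain M where M: "M \<in> \<A>" "\<And>R. R \<in> \<A> \<Longrightarrow> M \<subseteq> R \<Longrightarrow> R = M" by blast
  have hallM: "card J \<le> card (\<Union>i\<in>J. Y M i)" if "finite J" for J
    using M that by (auto simp: \<A>_def)
  \<comment> \<open>By maximality of \<open>M\<close>, deleting \<open>x\<close> as well breaks
    Hall's condition at some finite set containing \<open>i\<close>; \<open>J\<close> is that set
    without \<open>i\<close>, which turns \<open><\<close> into \<open>\<le>\<close>.\<close>
  have removal: "\<exists>J. finite J \<and> i \<notin> J \<and> card ((Y M i - {x}) \<union> (\<Union>j\<in>J. Y M j)) \<le> card J"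
    if x: "x \<in> Y M i" for i x
  proof -
    let ?R = "insert (i, x) M"
    have "?R \<notin> \<A>" using M(2)[of ?R] x by (auto simp: Y_def)
    then obtain J where J: "finite J" "card (\<Union>j\<in>J. Y ?R j) < card J"
      by (auto simp: \<A>_def not_le)
    have YR: "Y ?R j = (if j = i then Y M i - {x} else Y M j)" for j
      by (auto simp: Y_def)
    have "i \<in> J"
    proof (rule ccontr)
      assume "i \<notin> J"
      then have "(\<Union>j\<in>J. Y ?R j) = (\<Union>j\<in>J. Y M j)" by (intro SUP_cong) (auto simp: YR)
      then show False using J hallM[of J] by simp
    qed
    then have "(\<Union>j\<in>J. Y ?R j) = (Y M i - {x}) \<union> (\<Union>j\<in>J - {i}. Y M j)"
      by (auto simp: YR split: if_splits)
    then show ?thesis using J \<open>i \<in> J\<close> by (intro exI[of _ "J - {i}"]) auto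
  qed
  have single: "x = y" if xy: "x \<in> Y M i" "y \<in> Y M i" for i x y
  proof (rule ccontr)
    assume "x \<noteq> y"
    obtain J where J: "finite J" "i \<notin> J" "card ((Y M i - {x}) \<union> (\<Union>j\<in>J. Y M j)) \<le> card J"
      using removal xy by blast
    obtain K where K: "finite K" "i \<notin> K" "card ((Y M i - {y}) \<union> (\<Union>j\<in>K. Y M j)) \<le> card K"
      using removal xy by blast
    \<comment> \<open>As \<open>x \<noteq> y\<close>, the union \<open>P \<union> Q\<close> contains
      all of \<open>Y M i\<close>. Hall's condition for \<open>insert i (J \<union> K)\<close> and
      for \<open>J \<inter> K\<close> then gives \<open>card P + card Q > card J + card K\<close>,
      contrary to the choice of \<open>J\<close> and \<open>K\<close>.\<close>
    define P where "P = (Y M i - {x}) \<union> (\<Union>j\<in>J. Y M j)"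
    define Q where "Q = (Y M i - {y}) \<union> (\<Union>j\<in>K. Y M j)"
    have f: "finite P" "finite Q"
      using finY[of J M] finY[of K M] finY[of "{i}" M] J K by (auto simp: P_def Q_def)
    have "card (insert i (J \<union> K)) \<le> card (\<Union>j\<in>insert i (J \<union> K). Y M j)"
      using J K by (intro hallM) auto
    also have "\<dots> \<le> card (P \<union> Q)"
      using \<open>x \<noteq> y\<close> f by (intro card_mono) (auto simp: P_def Q_def)
    finally have 1: "card (J \<union> K) + 1 \<le> card (P \<union> Q)" using J K by simp
    have "card (J \<inter> K) \<le> card (\<Union>j\<in>J \<inter> K. Y M j)"
      using J K by (intro hallM) auto
    also have "\<dots> \<le> card (P \<inter> Q)"
      using f by (intro card_mono) (auto simp: P_def Q_def)
    finally have 2: "card (J \<inter> K) \<le> card (P \<inter> Q)" .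
    show False
      using 1 2 J K card_Un_Int[OF f] card_Un_Int[of J K] by (simp add: P_def Q_def)
  qed
  have "\<exists>x. x \<in> Y M i" for i
    using hallM[of "{i}"] by (auto simp: card_le_Suc0_iff_eq intro: ccontr)
  then obtain f where f: "\<And>i. f i \<in> Y M i" by metis
  then have Yf: "Y M i = {f i}" for i using single by blast
  have "inj f"
  proof (rule injI, rule ccontr)
    fix i j assume "f i = f j" "i \<noteq> j"
    then show False using hallM[of "{i, j}"] by (simp add: Yf)
  qed
  moreover have "f i \<in> X i" for i using f[of i] by (auto simp: Y_def)
  ultimately show ?thesis by blast
qed

text \<open>Hall's condition yields a paradoxical decomposition with translations from \<open>S\<close>.\<close>

lemma doubling_imp_not_amenable_group:
  fixes S :: "'g::group_add set"
  assumes S: "finite S" and dbl: "\<And>A. finite A \<Longrightarrow> 2 * card A \<le> card (A + S)"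
  shows "\<not> amenable_group TYPE('g)"
proof
  assume "amenable_group TYPE('g)"
  then obtain \<mu> :: "'g set \<Rightarrow> real" where \<mu>: "\<And>A. \<mu> A \<in> {0..1}" "\<mu> UNIV = 1"
      "\<And>A B. A \<inter> B = {} \<Longrightarrow> \<mu> (A \<union> B) = \<mu> A + \<mu> B" "\<And>A g. \<mu> ((\<lambda>a. a + g) ` A) = \<mu> A"
    unfolding amenable_group_def by blast
  have emp: "\<mu> {} = 0" using \<mu>(3)[of "{}" "{}"] by simp
  have \<mu>_UN: "\<mu> (\<Union>i\<in>I. B i) = (\<Sum>i\<in>I. \<mu> (B i))"
    if "finite I" "\<And>i j. i \<in> I \<Longrightarrow> j \<in> I \<Longrightarrow> i \<noteq> j \<Longrightarrow> B i \<inter> B j = {}"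
    for I :: "'i set" and B :: "'i \<Rightarrow> 'g set"
    using that
  proof (induction I rule: finite_induct)
    case (insert i I)
    have "B i \<inter> (\<Union>j\<in>I. B j) = {}" using insert by fastforce
    then show ?case using insert by (simp add: \<mu>(3))
  qed (simp add: emp)
  \<comment> \<open>The factor \<open>bool\<close> provides two copies of every element; an
    injective selection places both copies disjointly in the group, moving each element by some
    member of \<open>S\<close>.\<close>
  have "\<exists>\<phi> :: 'g \<times> bool \<Rightarrow> 'g. inj \<phi> \<and> (\<forall>p. \<phi> p \<in> {fst p} + S)"
  proof (rule hall_selection)
    show "finite ({fst p} + S)" for p :: "'g \<times> bool" using S by (simp add: finite_set_plus)
    fix J :: "('g \<times> bool) set" assume J: "finite J"
    have "card J \<le> card (fst ` J \<times> (UNIV :: bool set))"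
      using J by (intro card_mono) force+
    also have "\<dots> = 2 * card (fst ` J)" by (simp add: card_cartesian_product)
    also have "\<dots> \<le> card (fst ` J + S)" using J by (intro dbl) simp
    also have "fst ` J + S = (\<Union>p\<in>J. {fst p} + S)" by (force simp: set_plus_def)
    finally show "card J \<le> card (\<Union>p\<in>J. {fst p} + S)" .
  qed
  then obtain \<phi> :: "'g \<times> bool \<Rightarrow> 'g" where \<phi>: "inj \<phi>" "\<And>g b. \<phi> (g, b) \<in> {g} + S" by fastforce
  have \<phi>S: "\<exists>s\<in>S. \<phi> (g, b) = g + s" for g b
    using \<phi>(2)[of g b] by (auto simp: set_plus_def)
  \<comment> \<open>\<open>B (b, s)\<close> is the piece of copy \<open>b\<close> that is translated
    by \<open>s\<close>. For each \<open>b\<close> the pieces partition the group, yet all their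
    translates are disjoint, so the total measure would be both 2 and at most 1.\<close>
  define B where "B = (\<lambda>(b, s). {g. \<phi> (g, b) = g + s})"
  have part: "(\<Sum>s\<in>S. \<mu> (B (b, s))) = 1" for b
  proof -
    have "(\<Union>s\<in>S. B (b, s)) = UNIV" using \<phi>S by (auto simp: B_def)
    moreover have "\<mu> (\<Union>s\<in>S. B (b, s)) = (\<Sum>s\<in>S. \<mu> (B (b, s)))"
      using S by (intro \<mu>_UN) (auto simp: B_def)
    ultimately show ?thesis using \<mu>(2) by simp
  qed
  let ?I = "(UNIV :: bool set) \<times> S"
  have tr: "(\<lambda>a. a + snd i) ` B i = (\<lambda>g. \<phi> (g, fst i)) ` B i" for i
    by (auto simp: B_def image_iff split: prod.splits)
  have "(2::real) = (\<Sum>b\<in>(UNIV :: bool set). \<Sum>s\<in>S. \<mu> (B (b, s)))" by (simp add: part)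
  also have "\<dots> = (\<Sum>i\<in>?I. \<mu> (B i))" by (simp add: sum.cartesian_product)
  also have "\<dots> = (\<Sum>i\<in>?I. \<mu> ((\<lambda>a. a + snd i) ` B i))" by (simp add: \<mu>(4))
  also have "\<dots> = \<mu> (\<Union>i\<in>?I. (\<lambda>a. a + snd i) ` B i)"
  proof (rule \<mu>_UN[symmetric])
    fix i j assume "i \<in> ?I" "j \<in> ?I" "i \<noteq> j"
    moreover have "i = j" if g: "g \<in> B i" "h \<in> B j" "\<phi> (g, fst i) = \<phi> (h, fst j)" for g h
    proof -
      have "g = h" "fst i = fst j" using injD[OF \<phi>(1) g(3)] by auto
      then show ?thesis using g by (auto simp: B_def case_prod_unfold prod_eq_iff)
    qed
    ultimately show "(\<lambda>a. a + snd i) ` B i \<inter> (\<lambda>a. a + snd j) ` B j = {}"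
      unfolding tr by blast
  qed (use S in simp)
  also have "\<dots> \<le> 1" using \<mu>(1) by simp
  finally show False by simp
qed

text \<open>If adding \<open>E\<close> always enlarged a finite set at least by the factor
  \<open>1 + \<epsilon>\<close>, repeating this would eventually double every finite set.\<close>

lemma amenable_group_imp_folner:
  fixes E :: "'g::group_add set" and \<epsilon> :: real
  assumes G: "amenable_group TYPE('g)" and E: "finite E" and \<epsilon>: "\<epsilon> > 0"
  shows "\<exists>A. finite A \<and> A \<noteq> {} \<and> card (A + E) < (1 + \<epsilon>) * card A"
proof (rule ccontr)
  assume "\<not> ?thesis"
  then have grow: "(1 + \<epsilon>) * card A \<le> card (A + E)" if "finite A" for A
    using that by (cases "A = {}") (auto simp: not_less)
  \<comment> \<open>The n-fold sum of \<open>E\<close>; it becomes a doubling set as soon as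
    \<open>(1 + \<epsilon>) ^ n\<close> exceeds 2.\<close>
  define P where "P n = ((\<lambda>B. B + E) ^^ n) {0}" for n
  have P: "P 0 = {0}" "P (Suc n) = P n + E" for n by (simp_all add: P_def)
  have finP: "finite (P n)" for n
    by (induction n) (auto simp: P finite_set_plus E)
  have pow: "(1 + \<epsilon>) ^ n * card A \<le> card (A + P n)" if A: "finite A" for A n
  proof (induction n)
    case (Suc n)
    have "(1 + \<epsilon>) ^ Suc n * card A \<le> (1 + \<epsilon>) * card (A + P n)"
      using Suc \<epsilon> by (simp add: mult.assoc mult_left_mono)
    also have "\<dots> \<le> card (A + P n + E)" using A finP by (intro grow finite_set_plus)
    finally show ?case by (simp add: P add.assoc)
  qed (simp add: P set_plus_def)
  obtain n where n: "2 < (1 + \<epsilon>) ^ n" using real_arch_pow[of "1 + \<epsilon>" 2] \<epsilon> by auto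
  have "2 * card A \<le> card (A + P n)" if "finite A" for A
  proof -
    have "2 * real (card A) \<le> (1 + \<epsilon>) ^ n * card A" using n by (intro mult_right_mono) auto
    also note pow[OF that]
    finally show ?thesis by linarith
  qed
  with doubling_imp_not_amenable_group[of "P n"] finP G show False by blast
qed

section \<open>Invariant means as limits of almost invariant ones\<close>

text \<open>By Tychonoff's theorem the functions into \<open>{0..1}\<close> form a compact space, in
  which normalisation, additivity and each bound on the translation defect are closed conditions.
  Any finitely many of them can be met together, hence all of them can.\<close>

lemma amenable_groupI_approx:
  assumes "\<And>\<epsilon> T. \<epsilon> > 0 \<Longrightarrow> finite T \<Longrightarrow> \<exists>\<mu> :: 'g::group_add set \<Rightarrow> real.
      (\<forall>A. \<mu> A \<in> {0..1}) \<and> \<mu> UNIV = 1 \<and> (\<forall>A B. A \<inter> B = {} \<longrightarrow> \<mu> (A \<union> B) = \<mu> A + \<mu> B) \<and>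
      (\<forall>g\<in>T. \<forall>A. \<bar>\<mu> ((\<lambda>a. a + g) ` A) - \<mu> A\<bar> \<le> \<epsilon>)"
  shows "amenable_group TYPE('g)"
proof -
  let ?K = "PiE UNIV (\<lambda>_. {0..1}) :: ('g set \<Rightarrow> real) set"
  have "compactin (product_topology (\<lambda>_. euclidean) UNIV) ?K"
    by (simp add: compactin_PiE)
  then have K: "compact ?K" by (simp add: euclidean_product_topology)
  define N where "N = {\<mu> :: 'g set \<Rightarrow> real. \<mu> UNIV = 1} \<inter>
    (\<Inter>A. \<Inter>B\<in>{B. A \<inter> B = {}}. {\<mu>. \<mu> (A \<union> B) = \<mu> A + \<mu> B})"
  \<comment> \<open>\<open>C (n, g)\<close> bounds the defect under \<open>g\<close> by
    \<open>1 / (n + 1)\<close>, so a function lying in all of these sets is invariant.\<close>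
  define C where "C = (\<lambda>(n, g). N \<inter>
    (\<Inter>A. {\<mu> :: 'g set \<Rightarrow> real. \<bar>\<mu> ((\<lambda>a. a + g) ` A) - \<mu> A\<bar> \<le> inverse (real (Suc n))}))"
  have cl: "closed (C p)" for p
    unfolding C_def N_def case_prod_unfold
    by (intro closed_Int closed_INT ballI closed_Collect_eq closed_Collect_le continuous_intros
        continuous_on_product_coordinates)
  have "?K \<inter> (\<Inter>p\<in>UNIV. C p) \<noteq> {}"
  proof (rule compact_imp_fip_image[OF K cl])
    fix I :: "(nat \<times> 'g) set" assume I: "finite I"
    \<comment> \<open>The strictest tolerance among the finitely many constraints implies the
      others; \<open>insert 0\<close> covers an empty \<open>I\<close>.\<close>
    define n where "n = Max (insert 0 (fst ` I))"
    obtain \<mu> :: "'g set \<Rightarrow> real" where \<mu>: "\<forall>A. \<mu> A \<in> {0..1}" "\<mu> UNIV = 1"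
        "\<forall>A B. A \<inter> B = {} \<longrightarrow> \<mu> (A \<union> B) = \<mu> A + \<mu> B"
        "\<forall>g\<in>snd ` I. \<forall>A. \<bar>\<mu> ((\<lambda>a. a + g) ` A) - \<mu> A\<bar> \<le> inverse (real (Suc n))"
      using assms[of "inverse (real (Suc n))" "snd ` I"] I by auto
    have "\<mu> \<in> C p" if "p \<in> I" for p
    proof -
      have "fst p \<le> n" using that I by (auto simp: n_def)
      then have "inverse (real (Suc n)) \<le> inverse (real (Suc (fst p)))"
        by (intro le_imp_inverse_le) auto
      then have "\<bar>\<mu> ((\<lambda>a. a + snd p) ` A) - \<mu> A\<bar> \<le> inverse (real (Suc (fst p)))" for A
        using \<mu>(4) that by (meson imageI order_trans)
      then show ?thesis using \<mu> by (auto simp: C_def N_def case_prod_unfold)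
    qed
    moreover have "\<mu> \<in> ?K" using \<mu>(1) by auto
    ultimately show "?K \<inter> (\<Inter>p\<in>I. C p) \<noteq> {}" by blast
  qed
  then obtain \<mu> where \<mu>: "\<mu> \<in> ?K" "\<And>p. \<mu> \<in> C p" by blast
  have "\<mu> ((\<lambda>a. a + g) ` A) = \<mu> A" for A g
  proof (rule ccontr)
    assume "\<mu> ((\<lambda>a. a + g) ` A) \<noteq> \<mu> A"
    then obtain n where "inverse (real (Suc n)) < \<bar>\<mu> ((\<lambda>a. a + g) ` A) - \<mu> A\<bar>"
      using reals_Archimedean[of "\<bar>\<mu> ((\<lambda>a. a + g) ` A) - \<mu> A\<bar>"] by auto
    moreover have "\<bar>\<mu> ((\<lambda>a. a + g) ` A) - \<mu> A\<bar> \<le> inverse (real (Suc n))"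
      using \<mu>(2)[of "(n, g)"] by (auto simp: C_def)
    ultimately show False by simp
  qed
  moreover have "\<mu> \<in> N" using \<mu>(2)[of "(0, 0)"] by (simp add: C_def)
  ultimately show ?thesis
    unfolding amenable_group_def using \<mu>(1) by (intro exI[of _ \<mu>]) (auto simp: N_def PiE_iff)
qed

section \<open>Finite-dimensional subspaces\<close>

text \<open>Rank-nullity for one nonzero functional: \<open>v0\<close> extends a basis of the kernel
  to a basis of \<open>V\<close>. It is applied with \<open>\<phi>\<close> a coefficient of group
  algebra elements, to count dimensions one position at a time.\<close>

lemma (in vector_space) dim_eq_Suc_dim_kernel:
  fixes \<phi> :: "'b \<Rightarrow> 'a"
  assumes V: "subspace V" "V \<subseteq> span B" "finite B"
    and add: "\<And>u v. \<phi> (u + v) = \<phi> u + \<phi> v" and scale: "\<And>c v. \<phi> (scale c v) = c * \<phi> v"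
    and v0: "v0 \<in> V" "\<phi> v0 \<noteq> 0"
  shows "dim V = Suc (dim {v \<in> V. \<phi> v = 0})"
proof -
  let ?W = "{v \<in> V. \<phi> v = 0}"
  have \<phi>0: "\<phi> 0 = 0" using add[of 0 0] by (metis add_0 add_cancel_left_left)
  have W: "subspace ?W"
    using V(1) \<phi>0 by (auto simp: subspace_def add scale)
  obtain C where C: "C \<subseteq> ?W" "independent C" "?W \<subseteq> span C" "card C = dim ?W"
    using basis_exists[of ?W] by blast
  have finC: "finite C" using independent_span_bound[OF V(3) C(2)] C(1) V(2) by auto
  have "span C \<subseteq> ?W" using C(1) W by (rule span_minimal)
  then have v0C: "v0 \<notin> span C" using v0 by auto
  have "V \<subseteq> span (insert v0 C)"
  proof
    fix v assume v: "v \<in> V"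
    let ?c = "\<phi> v / \<phi> v0"
    have "\<phi> (v - scale ?c v0) + \<phi> (scale ?c v0) = \<phi> v" by (simp flip: add)
    then have "\<phi> (v - scale ?c v0) = 0" using v0 by (simp add: scale)
    moreover have "v - scale ?c v0 \<in> V"
      using V(1) v v0 by (intro subspace_diff subspace_scale) auto
    ultimately have "v - scale ?c v0 \<in> span C" using C(3) by blast
    then show "v \<in> span (insert v0 C)" using span_breakdown_eq by blast
  qed
  moreover have "insert v0 C \<subseteq> V" using C v0 by auto
  ultimately have "card (insert v0 C) = dim V"
    using C(2) v0C by (intro basis_card_eq_dim independent_insertI) auto
  moreover have "v0 \<notin> C" using v0C span_base by blast
  ultimately show ?thesis using finC C(4) by simp
qed

context assoc_algebra
begin

lemma fin_dim_subspace_span: "finite B \<Longrightarrow> fin_dim_subspace (span B)"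
  by (auto simp: fin_dim_subspace_def)

lemma fin_dim_subspace_plus:
  assumes "fin_dim_subspace U" "fin_dim_subspace V"
  shows "fin_dim_subspace (U + V)"
proof -
  obtain B C where "finite B" "span B = U" "finite C" "span C = V"
    using assms by (auto simp: fin_dim_subspace_def)
  moreover have "span (B \<union> C) = span B + span C"
    by (auto simp: span_Un set_plus_def)
  ultimately show ?thesis using fin_dim_subspace_span[of "B \<union> C"] by simp
qed

lemma fin_dim_subspace_mult:
  assumes "fin_dim_subspace V"
  shows "fin_dim_subspace ((\<lambda>v. v * s) ` V)"
proof -
  interpret m: module_hom scale scale "\<lambda>v. v * s"
    by unfold_locales (simp_all add: distrib_right scale_mult_left)
  obtain B where B: "finite B" "span B = V"
    using assms by (auto simp: fin_dim_subspace_def)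
  then have "span ((\<lambda>v. v * s) ` B) = (\<lambda>v. v * s) ` V" by (simp add: m.span_image)
  then show ?thesis using B fin_dim_subspace_span[of "(\<lambda>v. v * s) ` B"] by simp
qed

lemma subset_plus_mult:
  assumes "subspace U"
  shows "U \<subseteq> U + (\<lambda>v. v * s) ` U"
proof
  fix u assume "u \<in> U"
  moreover have "0 * s \<in> (\<lambda>v. v * s) ` U" using subspace_0[OF assms] by blast
  ultimately show "u \<in> U + (\<lambda>v. v * s) ` U" using set_plus_intro[of u U "0 * s"] by simp
qed

lemma dim_quotient_plus_mult:
  assumes "fin_dim_subspace U"
  shows "dim_quotient (U + (\<lambda>v. v * s) ` U) U = dim (U + (\<lambda>v. v * s) ` U) - dim U"
  using assms
  by (intro dim_quotient_eq subset_plus_mult fin_dim_subspace_plus fin_dim_subspace_mult)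
    (simp_all add: fin_dim_subspace_def)

lemma dim_pos:
  assumes "fin_dim_subspace V" "V \<noteq> {0}"
  shows "dim V > 0"
proof (rule ccontr)
  assume "\<not> dim V > 0"
  obtain B where B: "B \<subseteq> V" "independent B" "V \<subseteq> span B" "card B = dim V" by (rule basis_exists)
  obtain C where C: "finite C" "span C = V" using assms by (auto simp: fin_dim_subspace_def)
  \<comment> \<open>\<open>card\<close> is 0 for infinite sets too, so finiteness has to come before
    the conclusion that \<open>B\<close> is empty.\<close>
  have "finite B" using independent_span_bound[OF C(1) B(2)] B(1) C(2) by auto
  then have "B = {}" using B \<open>\<not> dim V > 0\<close> by simp
  then have "V \<subseteq> {0}" using B by simp
  moreover have "0 \<in> V" using C span_zero by blast
  ultimately show False using assms by blast
qed

end

section \<open>Subspaces of the group algebra with prescribed support\<close>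

interpretation ga: assoc_algebra "group_algebra_scale :: 'k::field \<Rightarrow> ('g::group_add \<Rightarrow>\<^sub>0 'k) \<Rightarrow> _"
  by (rule assoc_algebra_group_algebra)

lemma subspace_keys_subset:
  "ga.subspace {f :: 'g::group_add \<Rightarrow>\<^sub>0 'k::field. Poly_Mapping.keys f \<subseteq> A}"
  by (auto simp: ga.subspace_def in_keys_iff lookup_add lookup_group_algebra_scale subset_iff)
    (metis add.right_neutral)

lemma keys_subset_eq_span:
  fixes A :: "'g::group_add set"
  assumes "finite A"
  shows "{f :: 'g \<Rightarrow>\<^sub>0 'k::field. Poly_Mapping.keys f \<subseteq> A} =
    ga.span ((\<lambda>a. Poly_Mapping.single a 1) ` A)"
proof (intro equalityI subsetI)
  fix f :: "'g \<Rightarrow>\<^sub>0 'k" assume "f \<in> {f. Poly_Mapping.keys f \<subseteq> A}"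
  then have f: "Poly_Mapping.lookup f a = 0" if "a \<notin> A" for a
    using that by (auto simp: in_keys_iff)
  have "f = (\<Sum>a\<in>A. group_algebra_scale (Poly_Mapping.lookup f a) (Poly_Mapping.single a 1))"
    using assms f
    by (intro poly_mapping_eqI)
      (auto simp: lookup_sum lookup_group_algebra_scale lookup_single when_def if_distrib cong: if_cong)
  also have "\<dots> \<in> ga.span ((\<lambda>a. Poly_Mapping.single a 1) ` A)"
    by (intro ga.span_sum ga.span_scale ga.span_base) auto
  finally show "f \<in> ga.span ((\<lambda>a. Poly_Mapping.single a 1) ` A)" .
next
  fix f :: "'g \<Rightarrow>\<^sub>0 'k" assume f: "f \<in> ga.span ((\<lambda>a. Poly_Mapping.single a 1) ` A)"
  have "ga.span ((\<lambda>a. Poly_Mapping.single a 1) ` A) \<subseteq> {f :: 'g \<Rightarrow>\<^sub>0 'k. Poly_Mapping.keys f \<subseteq> A}"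
    using subspace_keys_subset by (intro ga.span_minimal) auto
  then show "f \<in> {f. Poly_Mapping.keys f \<subseteq> A}" using f by blast
qed

text \<open>Induction on \<open>A\<close>: among the elements supported on
  \<open>insert a A\<close>, those supported on \<open>A\<close> are the kernel of the coefficient
  at \<open>a\<close>.\<close>

lemma dim_keys_subset:
  fixes A :: "'g::group_add set"
  assumes "finite A"
  shows "ga.dim {f :: 'g \<Rightarrow>\<^sub>0 'k::field. Poly_Mapping.keys f \<subseteq> A} = card A"
  using assms
proof (induction A rule: finite_induct)
  case empty
  have "ga.dim ({} :: ('g \<Rightarrow>\<^sub>0 'k) set) = card ({} :: ('g \<Rightarrow>\<^sub>0 'k) set)"
    by (rule ga.dim_eq_card_independent) (rule ga.independent_empty)
  then show ?case using ga.dim_span[of "{} :: ('g \<Rightarrow>\<^sub>0 'k) set"] by simp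
next
  case (insert a A)
  let ?K = "\<lambda>A. {f :: 'g \<Rightarrow>\<^sub>0 'k. Poly_Mapping.keys f \<subseteq> A}"
  have "ga.dim (?K (insert a A)) = Suc (ga.dim {f \<in> ?K (insert a A). Poly_Mapping.lookup f a = 0})"
    using insert(1)
    by (intro ga.dim_eq_Suc_dim_kernel[where B = "(\<lambda>a. Poly_Mapping.single a 1) ` insert a A"
          and ?v0.0 = "Poly_Mapping.single a 1"])
      (use keys_subset_eq_span[of "insert a A"] subspace_keys_subset in
        \<open>auto simp: lookup_add lookup_group_algebra_scale\<close>)
  also have "{f \<in> ?K (insert a A). Poly_Mapping.lookup f a = 0} = ?K A"
    using insert(2) by (auto simp: in_keys_iff subset_iff)
  finally show ?case using insert by simp
qed

definition supp :: "('a \<Rightarrow>\<^sub>0 'k::zero) set \<Rightarrow> 'a set" where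
  "supp F = (\<Union>f\<in>F. Poly_Mapping.keys f)"

lemma finite_supp:
  assumes "ga.fin_dim_subspace (V :: ('g::group_add \<Rightarrow>\<^sub>0 'k::field) set)"
  shows "finite (supp V)"
proof -
  obtain B where B: "finite B" "ga.span B = V" using assms by (auto simp: ga.fin_dim_subspace_def)
  have "ga.span B \<subseteq> {f. Poly_Mapping.keys f \<subseteq> (\<Union>b\<in>B. Poly_Mapping.keys b)}"
    by (intro ga.span_minimal subspace_keys_subset) auto
  then have "supp V \<subseteq> (\<Union>b\<in>B. Poly_Mapping.keys b)" using B by (auto simp: supp_def)
  then show ?thesis by (rule finite_subset) (use B in simp)
qed

text \<open>Take for the subspace all elements supported on a Folner set \<open>A\<close>.
  Multiplication by members of \<open>S\<close> keeps supports inside \<open>A + E\<close>, so the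
  codimension is bounded by the growth of \<open>A\<close>.\<close>

lemma amenable_group_imp_amenable:
  assumes G: "amenable_group TYPE('g::group_add)"
  shows "assoc_algebra.amenable (group_algebra_scale :: 'k::field \<Rightarrow> ('g \<Rightarrow>\<^sub>0 'k) \<Rightarrow> ('g \<Rightarrow>\<^sub>0 'k))"
  unfolding ga.amenable_def
proof (intro allI impI)
  fix \<epsilon> :: real and S :: "('g \<Rightarrow>\<^sub>0 'k) set"
  assume \<epsilon>: "\<epsilon> > 0" and S: "ga.fin_dim_subspace S"
  let ?K = "\<lambda>A. {f :: 'g \<Rightarrow>\<^sub>0 'k. Poly_Mapping.keys f \<subseteq> A}"
  \<comment> \<open>One finite \<open>E\<close> serves all \<open>s\<close> in \<open>S\<close>;
    including 0 ensures \<open>A \<subseteq> A + E\<close>, so that \<open>?K A\<close> itself is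
    also contained in \<open>?K (A + E)\<close>.\<close>
  define E where "E = insert 0 (supp S)"
  have E: "finite E" using finite_supp[OF S] by (simp add: E_def)
  obtain A where A: "finite A" "A \<noteq> {}" "card (A + E) < (1 + \<epsilon>) * card A"
    using amenable_group_imp_folner[OF G E \<epsilon>] by blast
  have fd: "ga.fin_dim_subspace (?K A)"
    using A by (simp add: keys_subset_eq_span ga.fin_dim_subspace_span)
  have dimA: "ga.dim (?K A) = card A" using A by (intro dim_keys_subset)
  have pos: "card A > 0" using A by (simp add: card_gt_0_iff)
  have "real (ga.dim_quotient (?K A + (\<lambda>f. f * s) ` ?K A) (?K A)) / ga.dim (?K A) < \<epsilon>"
    if s: "s \<in> S" for s
  proof -
    let ?V = "?K A + (\<lambda>f. f * s) ` ?K A"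
    have ks: "Poly_Mapping.keys s \<subseteq> E" using s by (auto simp: E_def supp_def)
    have "?V \<subseteq> ?K (A + E)"
    proof
      fix v assume "v \<in> ?V"
      then obtain f h where fh: "Poly_Mapping.keys f \<subseteq> A" "Poly_Mapping.keys h \<subseteq> A" "v = f + h * s"
        by (auto simp: set_plus_def)
      have "A \<subseteq> A + E" by (force simp: E_def set_plus_def)
      moreover have "Poly_Mapping.keys (h * s) \<subseteq> A + E"
        using keys_mult[of h s] fh(2) ks by (force simp: set_plus_def)
      ultimately show "v \<in> ?K (A + E)"
        using keys_add[of f "h * s"] fh by blast
    qed
    also have "\<dots> = ga.span ((\<lambda>a. Poly_Mapping.single a 1) ` (A + E))"
      using A E by (intro keys_subset_eq_span finite_set_plus)
    finally have "ga.dim ?V \<le> card ((\<lambda>a. Poly_Mapping.single a (1::'k)) ` (A + E))"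
      using A E by (intro ga.dim_le_card finite_imageI finite_set_plus)
    also have "\<dots> \<le> card (A + E)"
      using A E by (intro card_image_le finite_set_plus)
    finally have dimV: "ga.dim ?V \<le> card (A + E)" .
    have "ga.dim_quotient ?V (?K A) = ga.dim ?V - card A"
      by (simp only: ga.dim_quotient_plus_mult[OF fd] dimA)
    \<comment> \<open>The subtraction is truncated; where it yields 0, the bound is the positivity
      of \<open>\<epsilon> * card A\<close>.\<close>
    then have "real (ga.dim_quotient ?V (?K A)) < \<epsilon> * card A"
      using dimV A(3) \<epsilon> pos by (simp add: of_nat_diff_if distrib_right)
    then show ?thesis using pos by (simp add: dimA divide_less_eq)
  qed
  moreover have "?K A \<noteq> {0}"
  proof -
    obtain a where "a \<in> A" using A by blast
    then have "Poly_Mapping.single a 1 \<in> ?K A" by simp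
    moreover have "Poly_Mapping.single a (1::'k) \<noteq> 0"
      by (metis lookup_single_eq lookup_zero zero_neq_one)
    ultimately show ?thesis by blast
  qed
  ultimately show "\<exists>F. ga.fin_dim_subspace F \<and> F \<noteq> {0} \<and>
      (\<forall>s\<in>S. real (ga.dim_quotient (F + (\<lambda>f. f * s) ` F) F) / real (ga.dim F) < \<epsilon>)"
    using fd by blast
qed

section \<open>The Shapley value\<close>

text \<open>For \<open>k < n\<close>, the probability that in a uniformly random ordering of
  \<open>n\<close> elements a given one is preceded by exactly a given set of \<open>k\<close>
  others.\<close>

definition shapley_weight :: "nat \<Rightarrow> nat \<Rightarrow> real" where
  "shapley_weight n k = fact k * fact (n - Suc k) / fact n"

lemma shapley_weight_nonneg: "shapley_weight n k \<ge> 0"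
  by (simp add: shapley_weight_def)

text \<open>An additional element of a random ordering comes either after or before the given one,
  leaving \<open>k\<close> or making \<open>k + 1\<close> predecessors.\<close>

lemma shapley_weight_split:
  assumes "k < n"
  shows "shapley_weight (Suc n) k + shapley_weight (Suc n) (Suc k) = shapley_weight n k"
proof -
  have "Suc n - Suc k = Suc (n - Suc k)" using assms by simp
  moreover have "(fact k * (real (Suc (n - Suc k)) * fact (n - Suc k)) + real (Suc k) * fact k * fact (n - Suc k))
      = fact k * fact (n - Suc k) * real (Suc n)"
    using assms by (simp add: algebra_simps of_nat_diff)
  ultimately show ?thesis
    by (simp add: shapley_weight_def field_simps del: of_nat_Suc)
qed

text \<open>This is the net coefficient of a set of size \<open>k\<close> in the sum of all marginal
  changes: it precedes each of the \<open>n - k\<close> elements outside it, and is reached by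
  adding any one of its \<open>k\<close> members. Only the empty and the full set survive. At
  \<open>k = 0\<close> the truncated \<open>k - 1\<close> is multiplied by 0.\<close>

lemma shapley_weight_balance:
  assumes "k \<le> n"
  shows "real (n - k) * shapley_weight n k - real k * shapley_weight n (k - 1) =
      of_bool (k = 0) - of_bool (k = n)"
proof -
  have 1: "real (n - k) * shapley_weight n k =
      (if k = n then 0 else fact k * fact (n - k) / fact n)"
  proof (cases "k = n")
    case False
    then have "n - k = Suc (n - Suc k)" using assms by simp
    then have "(fact (n - k) :: real) = real (n - k) * fact (n - Suc k)" by (metis fact_Suc)
    then show ?thesis using False by (simp add: shapley_weight_def)
  qed simp
  have 2: "real k * shapley_weight n (k - 1) =
      (if k = 0 then 0 else fact k * fact (n - k) / fact n)"
    by (cases k) (simp_all add: shapley_weight_def)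
  show ?thesis unfolding 1 2 using assms by auto
qed

text \<open>Efficiency of the Shapley value: along every ordering of \<open>Y\<close> the changes of
  \<open>d\<close> telescope. The proof collects the coefficient of each \<open>d Z\<close>
  instead.\<close>

lemma sum_shapley:
  fixes d :: "'a set \<Rightarrow> real"
  assumes Y: "finite Y"
  shows "(\<Sum>x\<in>Y. \<Sum>Z\<in>Pow (Y - {x}). shapley_weight (card Y) (card Z) * (d Z - d (insert x Z))) =
      d {} - d Y"
proof -
  let ?p = "shapley_weight (card Y)"
  have Pow_eq: "Pow (Y - {x}) = {Z \<in> Pow Y. x \<notin> Z}" for x by auto
  have 1: "(\<Sum>x\<in>Y. \<Sum>Z\<in>Pow (Y - {x}). ?p (card Z) * d Z) =
      (\<Sum>Z\<in>Pow Y. real (card Y - card Z) * ?p (card Z) * d Z)"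
  proof -
    have "(\<Sum>x\<in>Y. \<Sum>Z\<in>Pow (Y - {x}). ?p (card Z) * d Z) =
        (\<Sum>Z\<in>Pow Y. \<Sum>x | x \<in> Y \<and> x \<notin> Z. ?p (card Z) * d Z)"
      unfolding Pow_eq using Y by (intro sum.swap_restrict) auto
    also have "\<dots> = (\<Sum>Z\<in>Pow Y. real (card Y - card Z) * ?p (card Z) * d Z)"
    proof (rule sum.cong[OF refl])
      fix Z assume Z: "Z \<in> Pow Y"
      have "{x. x \<in> Y \<and> x \<notin> Z} = Y - Z" by auto
      moreover have "card (Y - Z) = card Y - card Z"
        using Z Y by (intro card_Diff_subset) (auto intro: finite_subset)
      ultimately show "(\<Sum>x | x \<in> Y \<and> x \<notin> Z. ?p (card Z) * d Z) =
          real (card Y - card Z) * ?p (card Z) * d Z"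
        by simp
    qed
    finally show ?thesis .
  qed
  have 2: "(\<Sum>x\<in>Y. \<Sum>Z\<in>Pow (Y - {x}). ?p (card Z) * d (insert x Z)) =
      (\<Sum>W\<in>Pow Y. real (card W) * ?p (card W - 1) * d W)"
  proof -
    \<comment> \<open>Reindexing by \<open>W = insert x Z\<close> turns \<open>card Z\<close> into
      \<open>card W - 1\<close>.\<close>
    have "(\<Sum>Z\<in>Pow (Y - {x}). ?p (card Z) * d (insert x Z)) =
        (\<Sum>W | W \<in> Pow Y \<and> x \<in> W. ?p (card W - 1) * d W)"
      if x: "x \<in> Y" for x
    proof (rule sum.reindex_bij_witness[of _ "\<lambda>W. W - {x}" "insert x"])
      fix Z assume Z: "Z \<in> Pow (Y - {x})"
      then have "finite Z" "x \<notin> Z" using Y by (auto intro: finite_subset)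
      then show "?p (card (insert x Z) - 1) * d (insert x Z) = ?p (card Z) * d (insert x Z)" by simp
    qed (use x in auto)
    then have "(\<Sum>x\<in>Y. \<Sum>Z\<in>Pow (Y - {x}). ?p (card Z) * d (insert x Z)) =
        (\<Sum>x\<in>Y. \<Sum>W | W \<in> Pow Y \<and> x \<in> W. ?p (card W - 1) * d W)"
      by (rule sum.cong[OF refl])
    also have "\<dots> = (\<Sum>W\<in>Pow Y. \<Sum>x | x \<in> Y \<and> x \<in> W. ?p (card W - 1) * d W)"
      using Y by (intro sum.swap_restrict) auto
    also have "\<dots> = (\<Sum>W\<in>Pow Y. real (card W) * ?p (card W - 1) * d W)"
    proof (rule sum.cong[OF refl])
      fix W assume "W \<in> Pow Y"
      then have "{x. x \<in> Y \<and> x \<in> W} = W" by auto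
      then show "(\<Sum>x | x \<in> Y \<and> x \<in> W. ?p (card W - 1) * d W) =
          real (card W) * ?p (card W - 1) * d W"
        by simp
    qed
    finally show ?thesis .
  qed
  have "(\<Sum>x\<in>Y. \<Sum>Z\<in>Pow (Y - {x}). ?p (card Z) * (d Z - d (insert x Z))) =
      (\<Sum>x\<in>Y. \<Sum>Z\<in>Pow (Y - {x}). ?p (card Z) * d Z) -
      (\<Sum>x\<in>Y. \<Sum>Z\<in>Pow (Y - {x}). ?p (card Z) * d (insert x Z))"
    by (simp add: right_diff_distrib sum_subtractf)
  also have "\<dots> =
      (\<Sum>Z\<in>Pow Y. (real (card Y - card Z) * ?p (card Z) - real (card Z) * ?p (card Z - 1)) * d Z)"
    unfolding 1 2 by (simp add: left_diff_distrib sum_subtractf)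
  also have "\<dots> = (\<Sum>Z\<in>Pow Y. of_bool (Z = {}) * d Z - of_bool (Z = Y) * d Z)"
  proof (rule sum.cong[OF refl])
    fix Z assume "Z \<in> Pow Y"
    then have "Z \<subseteq> Y" "finite Z" using Y by (auto intro: finite_subset)
    then have "card Z \<le> card Y" "card Z = card Y \<longleftrightarrow> Z = Y" "card Z = 0 \<longleftrightarrow> Z = {}"
      using Y card_subset_eq[OF Y] by (auto intro: card_mono)
    then show "(real (card Y - card Z) * ?p (card Z) - real (card Z) * ?p (card Z - 1)) * d Z =
        of_bool (Z = {}) * d Z - of_bool (Z = Y) * d Z"
      by (simp only: shapley_weight_balance left_diff_distrib[symmetric])
  qed
  also have "\<dots> = d {} - d Y"
    using Y by (simp add: sum_subtractf of_bool_def if_distrib[of "\<lambda>c. c * _"] cong: if_cong)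
  finally show ?thesis .
qed


section \<open>The Shapley value of a subspace of the group algebra\<close>

text \<open>With \<open>Z\<close> the set of positions before \<open>x\<close> in an ordering, this
  makes \<open>x\<close> the leading position of some member of \<open>F\<close>.\<close>

definition leads :: "('a \<Rightarrow>\<^sub>0 'k::zero) set \<Rightarrow> 'a set \<Rightarrow> 'a \<Rightarrow> bool" where
  "leads F Z x \<longleftrightarrow> (\<exists>f\<in>F. Poly_Mapping.lookup f x \<noteq> 0 \<and> (\<forall>z\<in>Z. Poly_Mapping.lookup f z = 0))"

text \<open>
  This is the probability that in a uniformly random ordering of \<open>Y\<close> the first element of the
  support of some member of \<open>F\<close> is \<open>x\<close>; equivalently, it is the Shapley value of \<open>x\<close> for the
  function taking \<open>Z\<close> to the dimension of the restriction of \<open>F\<close> to \<open>Z\<close>.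
\<close>

definition shapley_on :: "'a set \<Rightarrow> ('a \<Rightarrow>\<^sub>0 'k::zero) set \<Rightarrow> 'a \<Rightarrow> real" where
  "shapley_on Y F x =
    (\<Sum>Z\<in>Pow (Y - {x}). shapley_weight (card Y) (card Z) * of_bool (leads F Z x))"

lemma lookup_eq_0_if_notin_supp: "f \<in> F \<Longrightarrow> x \<notin> supp F \<Longrightarrow> Poly_Mapping.lookup f x = 0"
  by (auto simp: supp_def in_keys_iff)

lemma leads_mono: "F \<subseteq> F' \<Longrightarrow> leads F Z x \<Longrightarrow> leads F' Z x"
  by (auto simp: leads_def)

lemma leads_imp_supp: "leads F Z x \<Longrightarrow> x \<in> supp F"
  using lookup_eq_0_if_notin_supp by (fastforce simp: leads_def)

lemma leads_insert: "z \<notin> supp F \<Longrightarrow> leads F (insert z Z) x \<longleftrightarrow> leads F Z x"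
  using lookup_eq_0_if_notin_supp by (fastforce simp: leads_def)

lemma shapley_on_nonneg: "shapley_on Y F x \<ge> 0"
  unfolding shapley_on_def by (intro sum_nonneg mult_nonneg_nonneg shapley_weight_nonneg) auto

lemma shapley_on_eq_0: "x \<notin> supp F \<Longrightarrow> shapley_on Y F x = 0"
  using leads_imp_supp[of F _ x] by (auto simp: shapley_on_def intro!: sum.neutral)

lemma shapley_on_mono: "F \<subseteq> F' \<Longrightarrow> shapley_on Y F x \<le> shapley_on Y F' x"
  unfolding shapley_on_def
  by (intro sum_mono mult_left_mono shapley_weight_nonneg) (auto dest: leads_mono)

text \<open>Since \<open>z\<close> lies outside the support, it does not affect which positions
  lead. Pairing each \<open>Z\<close> with \<open>insert z Z\<close>, the two weights combine by
  \<open>shapley_weight_split\<close>.\<close>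

lemma shapley_on_insert:
  assumes Y: "finite Y" "supp F \<subseteq> Y" and z: "z \<notin> Y"
  shows "shapley_on (insert z Y) F x = shapley_on Y F x"
proof (cases "x \<in> supp F")
  case True
  then have x: "x \<in> Y" "x \<noteq> z" "z \<notin> supp F" using Y z by auto
  let ?P = "Pow (Y - {x})" and ?n = "card Y"
  have card: "card (insert z Y) = Suc ?n" using Y z by simp
  have fin: "finite Z" "card Z < ?n" "card (insert z Z) = Suc (card Z)" if "Z \<in> ?P" for Z
  proof -
    show f: "finite Z" using that Y by (auto intro: finite_subset)
    have "Z \<subset> Y" using that x by auto
    then show "card Z < ?n" using Y by (intro psubset_card_mono)
    show "card (insert z Z) = Suc (card Z)" using f that z by (intro card_insert_disjoint) auto
  qed
  have "insert z Y - {x} = insert z (Y - {x})" using x by auto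
  then have "Pow (insert z Y - {x}) = ?P \<union> insert z ` ?P" by (simp add: Pow_insert)
  moreover have "?P \<inter> insert z ` ?P = {}" using z by auto
  moreover have "inj_on (insert z) ?P"
    using z by (intro inj_onI) (metis Diff_iff PowD insert_ident subsetD)
  ultimately have "shapley_on (insert z Y) F x =
      (\<Sum>Z\<in>?P. shapley_weight (Suc ?n) (card Z) * of_bool (leads F Z x)) +
      (\<Sum>Z\<in>?P. shapley_weight (Suc ?n) (card (insert z Z)) * of_bool (leads F (insert z Z) x))"
    using Y by (simp add: shapley_on_def card sum.union_disjoint sum.reindex del: sum_mult_of_bool_eq)
  also have "\<dots> =
      (\<Sum>Z\<in>?P. (shapley_weight (Suc ?n) (card Z) + shapley_weight (Suc ?n) (Suc (card Z))) *
      of_bool (leads F Z x))"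
    using fin(3) x by (simp add: leads_insert distrib_right sum.distrib)
  also have "\<dots> = shapley_on Y F x"
    unfolding shapley_on_def using fin(2) by (intro sum.cong) (auto simp: shapley_weight_split)
  finally show ?thesis .
qed (simp add: shapley_on_eq_0)

text \<open>Lets subspaces with different supports be compared on one common finite set.\<close>

lemma shapley_on_superset:
  assumes "finite Y" "supp F \<subseteq> Y"
  shows "shapley_on Y F x = shapley_on (supp F) F x"
proof -
  have supp: "finite (supp F)" using assms by (rule rev_finite_subset)
  have "shapley_on (supp F \<union> D) F x = shapley_on (supp F) F x" if "finite D" for D
    using that
  proof (induction D rule: finite_induct)
    case (insert d D)
    then show ?case
      using supp shapley_on_insert[of "supp F \<union> D" F d x]
      by (cases "d \<in> supp F") (auto simp: insert_absorb)
  qed simp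
  from this[of Y] show ?thesis using assms by (simp add: Un_absorb1)
qed

text \<open>Apply \<open>sum_shapley\<close> to the dimension of the space of members of
  \<open>F\<close> vanishing on \<open>Z\<close>, which falls from \<open>ga.dim F\<close> at
  \<open>Z = {}\<close> to 0 at \<open>Z = Y\<close>.\<close>

lemma sum_shapley_on:
  fixes F :: "('g::group_add \<Rightarrow>\<^sub>0 'k::field) set"
  assumes F: "ga.fin_dim_subspace F" and Y: "finite Y" "supp F \<subseteq> Y"
  shows "(\<Sum>x\<in>Y. shapley_on Y F x) = ga.dim F"
proof -
  define V where "V Z = {f \<in> F. \<forall>z\<in>Z. Poly_Mapping.lookup f z = 0}" for Z
  obtain B where B: "finite B" "ga.span B = F" using F by (auto simp: ga.fin_dim_subspace_def)
  have sF: "ga.subspace F" using F by (simp add: ga.fin_dim_subspace_def)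
  have V: "ga.subspace (V Z)" for Z
    using sF by (auto simp: ga.subspace_def V_def lookup_add lookup_group_algebra_scale)
  \<comment> \<open>The coefficient at \<open>x\<close> is a functional on \<open>V Z\<close> with
    kernel \<open>V (insert x Z)\<close>; it is nonzero exactly when \<open>x\<close> leads.\<close>
  have step: "of_bool (leads F Z x) = real (ga.dim (V Z)) - real (ga.dim (V (insert x Z)))" for Z x
  proof -
    have ins: "V (insert x Z) = {f \<in> V Z. Poly_Mapping.lookup f x = 0}" by (auto simp: V_def)
    show ?thesis
    proof (cases "leads F Z x")
      case True
      then obtain f where "f \<in> V Z" "Poly_Mapping.lookup f x \<noteq> 0" by (auto simp: leads_def V_def)
      then have "ga.dim (V Z) = Suc (ga.dim (V (insert x Z)))"
        unfolding ins
        by (intro ga.dim_eq_Suc_dim_kernel[OF V _ B(1)])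
          (auto simp: B V_def lookup_add lookup_group_algebra_scale)
      then show ?thesis using True by simp
    next
      case False
      then have "V (insert x Z) = V Z" unfolding ins by (auto simp: leads_def V_def)
      then show ?thesis using False by simp
    qed
  qed
  have "f = 0" if "f \<in> V Y" for f
    using that Y(2) lookup_eq_0_if_notin_supp[of f F]
    by (intro poly_mapping_eqI) (auto simp: V_def)
  then have "V Y \<subseteq> ga.span {}" by auto
  then have VY: "ga.dim (V Y) = 0" using ga.dim_le_card[of "V Y" "{}"] by simp
  have "(\<Sum>x\<in>Y. shapley_on Y F x) = real (ga.dim (V {})) - real (ga.dim (V Y))"
    unfolding shapley_on_def step by (rule sum_shapley[OF Y(1)])
  then show ?thesis using VY by (simp add: V_def)
qed

lemma lookup_times_single:
  fixes f :: "'g::group_add \<Rightarrow>\<^sub>0 'k::field"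
  shows "Poly_Mapping.lookup (f * Poly_Mapping.single g c) x = Poly_Mapping.lookup f (x - g) * c"
proof -
  have inner: "Sum_any (\<lambda>q. (c when g = q) when x = l + q) = (if l = x - g then c else 0)" for l
  proof -
    have "(\<lambda>q. (c when g = q) when x = l + q) =
        (\<lambda>q. if q = g then (if l = x - g then c else 0) else 0)"
      by (auto simp: when_def fun_eq_iff)
    then show ?thesis by (simp only: Sum_any.delta)
  qed
  have "Poly_Mapping.lookup (f * Poly_Mapping.single g c) x =
      Sum_any (\<lambda>l. if l = x - g then Poly_Mapping.lookup f l * c else 0)"
    unfolding lookup_mult lookup_single inner by (rule arg_cong[where f = Sum_any]) (auto simp: fun_eq_iff)
  then show ?thesis by simp
qed

context
  fixes F Fg :: "('g::group_add \<Rightarrow>\<^sub>0 'k::field) set" and g :: 'g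
  defines "Fg \<equiv> (\<lambda>f. f * Poly_Mapping.single g 1) ` F"
begin

lemma leads_translate: "leads Fg ((\<lambda>a. a + g) ` Z) (x + g) \<longleftrightarrow> leads F Z x"
  by (simp add: leads_def Fg_def lookup_times_single)

lemma supp_translate: "supp Fg = (\<lambda>a. a + g) ` supp F"
proof -
  have "x \<in> supp Fg \<longleftrightarrow> x - g \<in> supp F" for x
    by (simp add: supp_def Fg_def in_keys_iff lookup_times_single)
  moreover have "x \<in> (\<lambda>a. a + g) ` A \<longleftrightarrow> x - g \<in> A" for x A
    by (metis (no_types, lifting) add_diff_cancel diff_add_cancel image_iff)
  ultimately show ?thesis by blast
qed

text \<open>The weights depend on cardinalities alone, so the sets \<open>Z\<close> can be reindexed
  by their translates.\<close>

lemma shapley_on_translate: "shapley_on ((\<lambda>a. a + g) ` Y) Fg (x + g) = shapley_on Y F x"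
proof -
  let ?t = "\<lambda>a. a + g"
  have inj: "inj_on ?t A" for A by (auto simp: inj_on_def)
  have "?t ` Y - {x + g} = ?t ` (Y - {x})" by auto
  then have "Pow (?t ` Y - {x + g}) = (`) ?t ` Pow (Y - {x})" by (simp add: image_Pow_surj)
  moreover have "inj_on ((`) ?t) (Pow (Y - {x}))" using inj by (rule inj_on_image_Pow)
  ultimately show ?thesis
    by (simp add: shapley_on_def sum.reindex card_image[OF inj] leads_translate)
qed

end

section \<open>The finitely additive measure of a subspace\<close>

text \<open>Intersecting with \<open>supp F\<close>, which is finite for finite-dimensional
  \<open>F\<close>, gives a finite sum for arbitrary \<open>A\<close>. Divided by the dimension of
  \<open>F\<close> this becomes the approximate mean.\<close>

definition mass :: "('a \<Rightarrow>\<^sub>0 'k::zero) set \<Rightarrow> 'a set \<Rightarrow> real" where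
  "mass F A = (\<Sum>x\<in>A \<inter> supp F. shapley_on (supp F) F x)"

lemma mass_eq:
  assumes "finite Y" "supp F \<subseteq> Y"
  shows "mass F A = (\<Sum>x\<in>A \<inter> Y. shapley_on Y F x)"
  unfolding mass_def
  using assms by (intro sum.mono_neutral_cong_left) (auto simp: shapley_on_eq_0 shapley_on_superset)

lemma mass_nonneg: "mass F A \<ge> 0"
  unfolding mass_def by (intro sum_nonneg shapley_on_nonneg)

lemma mass_Un:
  assumes "finite (supp F)" "A \<inter> B = {}"
  shows "mass F (A \<union> B) = mass F A + mass F B"
  unfolding mass_def Int_Un_distrib2 using assms by (intro sum.union_disjoint) auto

lemma mass_UNIV: "ga.fin_dim_subspace F \<Longrightarrow> mass F UNIV = ga.dim F"
  by (simp add: mass_def sum_shapley_on finite_supp)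

lemma mass_mono:
  assumes "finite (supp F')" "F \<subseteq> F'"
  shows "mass F A \<le> mass F' A"
proof -
  have "supp F \<subseteq> supp F'" using assms by (auto simp: supp_def)
  then have "mass F A = (\<Sum>x\<in>A \<inter> supp F'. shapley_on (supp F') F x)"
    by (rule mass_eq[OF assms(1)])
  also have "\<dots> \<le> mass F' A"
    unfolding mass_def by (intro sum_mono shapley_on_mono assms)
  finally show ?thesis .
qed

text \<open>The difference of the total masses is that of the dimensions, and by monotonicity the
  complement of \<open>A\<close> contributes a nonnegative part of it.\<close>

lemma mass_diff_le:
  fixes F V :: "('g::group_add \<Rightarrow>\<^sub>0 'k::field) set"
  assumes F: "ga.fin_dim_subspace F" and V: "ga.fin_dim_subspace V" and "F \<subseteq> V"
  shows "mass V A - mass F A \<le> real (ga.dim V) - real (ga.dim F)"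
proof -
  have "mass X UNIV = mass X A + mass X (- A)" if "ga.fin_dim_subspace X" for X :: "('g \<Rightarrow>\<^sub>0 'k) set"
    using mass_Un[of X A "- A"] finite_supp[OF that] by simp
  from this[OF F] this[OF V] mass_mono[OF finite_supp[OF V] \<open>F \<subseteq> V\<close>, of "- A"]
  show ?thesis by (simp add: mass_UNIV F V)
qed

lemma mass_translate:
  fixes F :: "('g::group_add \<Rightarrow>\<^sub>0 'k::field) set"
  shows "mass ((\<lambda>f. f * Poly_Mapping.single g 1) ` F) ((\<lambda>a. a + g) ` A) = mass F A"
proof -
  have inj: "inj_on (\<lambda>a. a + g) B" for B by (auto simp: inj_on_def)
  have "(\<lambda>a. a + g) ` A \<inter> (\<lambda>a. a + g) ` supp F = (\<lambda>a. a + g) ` (A \<inter> supp F)" by auto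
  then show ?thesis
    by (simp add: mass_def supp_translate sum.reindex[OF inj] shapley_on_translate)
qed

text \<open>\<open>F\<close> and \<open>Fg\<close> have the same codimension in
  \<open>F + Fg\<close>, so on any set the mass of \<open>F + Fg\<close> exceeds each of theirs by
  an amount between 0 and that codimension. On the translate of \<open>A\<close>, the mass of
  \<open>Fg\<close> is the mass of \<open>F\<close> on \<open>A\<close>.\<close>

lemma mass_almost_invariant:
  fixes F :: "('g::group_add \<Rightarrow>\<^sub>0 'k::field) set" and g :: 'g
  assumes F: "ga.fin_dim_subspace F"
  defines "Fg \<equiv> (\<lambda>f. f * Poly_Mapping.single g 1) ` F"
  shows "\<bar>mass F ((\<lambda>a. a + g) ` A) - mass F A\<bar> \<le> real (ga.dim_quotient (F + Fg) F)"
proof -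
  let ?A = "(\<lambda>a. a + g) ` A"
  have Fg: "ga.fin_dim_subspace Fg" unfolding Fg_def by (rule ga.fin_dim_subspace_mult[OF F])
  have V: "ga.fin_dim_subspace (F + Fg)" by (rule ga.fin_dim_subspace_plus[OF F Fg])
  have sub: "F \<subseteq> F + Fg"
    using F unfolding Fg_def by (intro ga.subset_plus_mult) (simp add: ga.fin_dim_subspace_def)
  have "0 \<in> F" using F ga.subspace_0 by (auto simp: ga.fin_dim_subspace_def)
  then have subg: "Fg \<subseteq> F + Fg" using set_plus_intro[of 0 F _ Fg] by auto
  \<comment> \<open>Total mass is dimension and is preserved by translation, whence
    \<open>Fg\<close> and \<open>F\<close> have equal dimension.\<close>
  have "surj (\<lambda>a. a + g)" by (rule surjI[of _ "\<lambda>a. a - g"]) simp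
  then have "mass Fg UNIV = mass F UNIV"
    using mass_translate[of g F UNIV] by (simp add: Fg_def)
  then have dim: "ga.dim Fg = ga.dim F" by (simp add: mass_UNIV F Fg)
  have "mass Fg ?A = mass F A" unfolding Fg_def by (rule mass_translate)
  moreover have "real (ga.dim (F + Fg)) - real (ga.dim F) \<le> real (ga.dim_quotient (F + Fg) F)"
    unfolding Fg_def ga.dim_quotient_plus_mult[OF F] by linarith
  ultimately show ?thesis
    using mass_mono[OF finite_supp[OF V] sub, of ?A] mass_mono[OF finite_supp[OF V] subg, of ?A]
      mass_diff_le[OF F V sub, of ?A] mass_diff_le[OF Fg V subg, of ?A] dim
    by linarith
qed

section \<open>Approximate means from almost invariant subspaces\<close>

lemma amenable_imp_amenable_group:
  assumes am: "assoc_algebra.amenable (group_algebra_scale :: 'k::field \<Rightarrow> ('g::group_add \<Rightarrow>\<^sub>0 'k) \<Rightarrow> _)"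
  shows "amenable_group TYPE('g)"
proof (rule amenable_groupI_approx)
  fix \<epsilon> :: real and T :: "'g set"
  assume \<epsilon>: "\<epsilon> > 0" and T: "finite T"
  \<comment> \<open>Algebra amenability is invoked for the span of the group elements from
    \<open>T\<close>, since right multiplication by these translates positions.\<close>
  let ?s = "\<lambda>g :: 'g. Poly_Mapping.single g (1 :: 'k)"
  have "finite (?s ` T)" using T by simp
  from am[unfolded ga.amenable_def, rule_format, OF \<epsilon> ga.fin_dim_subspace_span[OF this]]
  obtain F where F: "ga.fin_dim_subspace F" "F \<noteq> {0}"
      and small: "\<And>s. s \<in> ga.span (?s ` T) \<Longrightarrow>
        real (ga.dim_quotient (F + (\<lambda>f. f * s) ` F) F) / real (ga.dim F) < \<epsilon>"
    by blast
  have pos: "real (ga.dim F) > 0" using ga.dim_pos[OF F] by simp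
  define \<mu> where "\<mu> A = mass F A / real (ga.dim F)" for A
  have Un: "\<mu> (A \<union> B) = \<mu> A + \<mu> B" if "A \<inter> B = {}" for A B
    using mass_Un[OF finite_supp[OF F(1)] that] by (simp add: \<mu>_def add_divide_distrib)
  have UNIV: "\<mu> UNIV = 1" using pos by (simp add: \<mu>_def mass_UNIV[OF F(1)])
  have nonneg: "\<mu> A \<ge> 0" for A by (simp add: \<mu>_def mass_nonneg)
  have "\<mu> A \<in> {0..1}" for A using Un[of A "- A"] UNIV nonneg[of A] nonneg[of "- A"] by simp
  moreover have "\<bar>\<mu> ((\<lambda>a. a + g) ` A) - \<mu> A\<bar> \<le> \<epsilon>" if "g \<in> T" for g A
  proof -
    have "\<bar>\<mu> ((\<lambda>a. a + g) ` A) - \<mu> A\<bar> = \<bar>mass F ((\<lambda>a. a + g) ` A) - mass F A\<bar> / real (ga.dim F)"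
      by (simp add: \<mu>_def flip: diff_divide_distrib)
    also have "\<dots> \<le> real (ga.dim_quotient (F + (\<lambda>f. f * ?s g) ` F) F) / real (ga.dim F)"
      using pos by (intro divide_right_mono mass_almost_invariant F) simp
    also have "\<dots> < \<epsilon>" using that by (intro small ga.span_base) simp
    finally show ?thesis by simp
  qed
  ultimately show "\<exists>\<mu> :: 'g set \<Rightarrow> real.
      (\<forall>A. \<mu> A \<in> {0..1}) \<and> \<mu> UNIV = 1 \<and> (\<forall>A B. A \<inter> B = {} \<longrightarrow> \<mu> (A \<union> B) = \<mu> A + \<mu> B) \<and>
      (\<forall>g\<in>T. \<forall>A. \<bar>\<mu> ((\<lambda>a. a + g) ` A) - \<mu> A\<bar> \<le> \<epsilon>)"
    using Un UNIV by blast
qed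

theorem corollary1p5:
  shows "amenable_group TYPE('g::group_add) \<longleftrightarrow>
    assoc_algebra.amenable (group_algebra_scale :: 'k::field \<Rightarrow> ('g \<Rightarrow>\<^sub>0 'k) \<Rightarrow> ('g \<Rightarrow>\<^sub>0 'k))"
  using amenable_group_imp_amenable amenable_imp_amenable_group by blast

end
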